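(* Let $\nu\ge 0$. There is a constant $M_\nu$ (not depending on $x$) such that for every $g\in C_\rho^{*}(\mathbb{R}^+)$ and every integer $n>6$, $$\sup_{x\in[0,\infty)}\frac{\left|T_n(g;x)-g(x)\right|}{(1+x^2)^3}\le M_\nu\left(1+\frac1n\right)\Omega\left(g;\frac{1}{\sqrt n}\right).$$
   Context: Fix a real $\nu\ge 0$. For $r\in\mathbb{N}_0$ let $$\gamma_\nu(2r)=\frac{2^{2r}\,r!\,\Gamma(r+\nu+1/2)}{\Gamma(\nu+1/2)},\qquad \gamma_\nu(2r+1)=\frac{2^{2r+1}\,r!\,\Gamma(r+\nu+3/2)}{\Gamma(\nu+1/2)},$$ and $e_\nu(x)=\sum_{r=0}^{\infty}\frac{x^r}{\gamma_\nu(r)}$. For an integer $n\ge 1$, $x\ge 0$ and a continuous function $g$ on $[0,\infty)$ for which the integrals exist finitely, define $$T_n(g;x)=\frac{n-1}{e_\nu(nx)}\sum_{r=1}^{\infty}\binom{n+r-2}{r-1}\frac{(nx)^r}{\gamma_\nu(r)}\int_0^\infty s^{r-1}(1+s)^{-n-r+1}g(s)\,ds+\frac{g(0)}{e_\nu(nx)}.$$ Here $\mathbb{R}^+=[0,\infty)$ and $\rho(x)=1+x^2$. $B_\rho(\mathbb{R}^+)$ is the set of functions $g$ on $[0,\infty)$ with $|g(x)|\le M_g\,\rho(x)$ for all $x\ge 0$, where $M_g$ is a constant depending only on $g$; $C_\rho(\mathbb{R}^+)=C[0,\infty)\cap B_\rho(\mathbb{R}^+)$; and $C_\rho^{*}(\mathbb{R}^+)$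 is the set of $g\in C_\rho(\mathbb{R}^+)$ such that $\lim_{x\to\infty}\frac{g(x)}{\rho(x)}$ exists and is a (finite) constant. For $g\in C_\rho^{*}(\mathbb{R}^+)$ the weighted modulus of continuity is $$\Omega(g;\delta)=\sup_{x\in[0,\infty),\ |h|\le\delta}\frac{|g(x+h)-g(x)|}{(1+h^2)(1+x^2)},$$ where only $h$ with $x+h\ge 0$ are considered. *)

theory Defs
  imports "HOL-Analysis.Analysis"
begin

text \<open>Functions on \<open>[0,\<infinity>)\<close> are represented by total functions of type \<open>real \<Rightarrow> real\<close>;
  nothing below looks at their values at negative arguments.\<close>

definition dunkl_gamma :: "real \<Rightarrow> nat \<Rightarrow> real" where
  "dunkl_gamma \<nu> k =
     (let r = k div 2 in
      if even k
      then 2 ^ (2 * r) * fact r * Gamma (real r + \<nu> + 1/2) / Gamma (\<nu> + 1/2)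
      else 2 ^ (2 * r + 1) * fact r * Gamma (real r + \<nu> + 3/2) / Gamma (\<nu> + 1/2))"

definition dunkl_exp :: "real \<Rightarrow> real \<Rightarrow> real" where
  "dunkl_exp \<nu> x = (\<Sum>r. x ^ r / dunkl_gamma \<nu> r)"

text \<open>Only used for \<open>n \<ge> 1\<close> and \<open>r \<ge> 1\<close>, where the subtractions on \<open>nat\<close> are exact.\<close>

definition T_term :: "real \<Rightarrow> nat \<Rightarrow> (real \<Rightarrow> real) \<Rightarrow> real \<Rightarrow> nat \<Rightarrow> real" where
  "T_term \<nu> n g x r =
     real ((n + r - 2) choose (r - 1)) * ((real n * x) ^ r / dunkl_gamma \<nu> r) *
     (LBINT s:{0..}. s ^ (r - 1) * (1 + s) powi (- int n - int r + 1) * g s)"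

definition T_op :: "real \<Rightarrow> nat \<Rightarrow> (real \<Rightarrow> real) \<Rightarrow> real \<Rightarrow> real" where
  "T_op \<nu> n g x =
     (real n - 1) / dunkl_exp \<nu> (real n * x) * (\<Sum>i. T_term \<nu> n g x (Suc i))
     + g 0 / dunkl_exp \<nu> (real n * x)"

definition rho :: "real \<Rightarrow> real" where
  "rho x = 1 + x\<^sup>2"

definition B_rho :: "(real \<Rightarrow> real) set" where
  "B_rho = {g. \<exists>M. \<forall>x\<ge>0. \<bar>g x\<bar> \<le> M * rho x}"

definition C_rho :: "(real \<Rightarrow> real) set" where
  "C_rho = {g. continuous_on {0..} g} \<inter> B_rho"

definition C_rho_star :: "(real \<Rightarrow> real) set" where
  "C_rho_star = {g \<in> C_rho. \<exists>l. ((\<lambda>x. g x / rho x) \<longlongrightarrow> l) at_top}"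

text \<open>The supremum is taken in \<open>ereal\<close>, so that it is meaningful without a separate proof of
  boundedness.\<close>

definition wmod :: "(real \<Rightarrow> real) \<Rightarrow> real \<Rightarrow> ereal" where
  "wmod g \<delta> =
     (SUP (x, h) \<in> {(x, h). 0 \<le> x \<and> \<bar>h\<bar> \<le> \<delta> \<and> 0 \<le> x + h}.
        ereal (\<bar>g (x + h) - g x\<bar> / ((1 + h\<^sup>2) * (1 + x\<^sup>2))))"

end

theory Submission
  imports Defs "HOL-Probability.Giry_Monad"
begin

text \<open>
  Dividing the weights \<open>(n x)\<^sup>r / \<gamma>\<^sub>\<nu>(r)\<close> by \<open>e\<^sub>\<nu>(n x)\<close> gives a probability distribution in \<open>r\<close>, and in the
  \<open>r\<close>-th term the kernel, together with \<open>n - 1\<close> and the binomial coefficient, is the density of a beta prime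
  distribution. The summand with \<open>g(0)\<close> plays the part of \<open>r = 0\<close>, with a point mass at \<open>0\<close>. So
  \<open>T\<^sub>n(g; x)\<close> is the expectation of \<open>g\<close> under a mixture of probability measures (\<open>T_op_eq_mixture\<close>), and
  \<open>\<bar>T\<^sub>n(g; x) - g(x)\<bar>\<close> is at most the expectation of \<open>\<bar>g(s) - g(x)\<bar>\<close>.

  Walking from \<open>x\<close> to \<open>s\<close> in steps of length at most \<open>\<delta> = 1 / sqrt n\<close> bounds \<open>\<bar>g(s) - g(x)\<bar>\<close> by
  \<open>2 \<Omega>(g; \<delta>) (1 + \<delta>\<^sup>2) (1 + x\<^sup>2)\<close> times \<open>(1 + \<bar>s - x\<bar> / \<delta>) (1 + (s - x)\<^sup>2)\<close>
  (\<open>weighted_increment_le\<close>). As \<open>\<delta> \<le> 1\<close>, the last product is at most \<open>4 (1 + n\<^sup>2 (s - x)\<^sup>4)\<close>. Hence only one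
  moment is needed: the expectation of \<open>(s - x)\<^sup>4\<close> must be at most a constant times \<open>(1 + x\<^sup>2)\<^sup>2 / n\<^sup>2\<close>. The two
  remaining factors \<open>1 + x\<^sup>2\<close> and \<open>(1 + x\<^sup>2)\<^sup>2\<close> together make up the cube in the claim.

  The fourth moment has two sources. For fixed \<open>r\<close>, the variable \<open>s\<close> fluctuates around its mean
  \<open>m = r / (n - 2)\<close>, and the beta integral gives the fourth central moment exactly
  (\<open>beta_prime_central_moment4\<close>); it is at most \<open>69 (1 + m)\<^sup>4 / n\<^sup>2\<close> for \<open>n > 6\<close>. The index \<open>r\<close> in turn fluctuates
  around \<open>y = n x\<close>. Here the quotient \<open>a\<^sub>r = \<gamma>\<^sub>\<nu>(r) / \<gamma>\<^sub>\<nu>(r - 1)\<close>, which differs from \<open>r\<close> by at most \<open>2 \<nu>\<close>, is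
  the right variable, because a shift of the summation index yields the identity
  \<open>E ((a\<^sub>r - y) f r) = y E (f (r + 1) - f r)\<close> (\<open>dunkl_stein_identity\<close>). Applied to powers of \<open>a\<^sub>r - y\<close> it shows
  that the second moment is \<open>O(y)\<close> and the fourth is \<open>O(y\<^sup>2 + y)\<close>, which is what is needed after
  division by \<open>n\<^sup>4\<close>.
\<close>

section \<open>Beta prime distributions\<close>

text \<open>The polynomial antiderivative comes from integrating by parts in \<open>k\<close>: the boundary term
  \<open>u\<^sup>p\<^sup>+\<^sup>1 (1 - u)\<^sup>k\<^sup>+\<^sup>1\<close> vanishes at \<open>0\<close> and at \<open>1\<close>.\<close>

lemma beta_antiderivative:
  "\<exists>F. (\<forall>u::real. (F has_real_derivative u ^ p * (1 - u) ^ k) (at u)) \<and>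
       F 1 - F 0 = fact p * fact k / fact (p + k + 1)"
proof (induction k arbitrary: p)
  case 0
  have "((\<lambda>u. u ^ Suc p / real (Suc p)) has_real_derivative u ^ p * (1 - u) ^ 0) (at u)" for u
    using DERIV_cdivide[OF DERIV_pow[of "Suc p" u UNIV], of "real (Suc p)"]
    by (simp del: of_nat_Suc power_Suc)
  then show ?case
    by (intro exI[of _ "\<lambda>u. u ^ Suc p / real (Suc p)"]) (simp add: field_simps del: of_nat_Suc)
next
  case (Suc k)
  obtain F where F: "\<And>u::real. (F has_real_derivative u ^ Suc p * (1 - u) ^ k) (at u)"
    and F01: "F 1 - F 0 = fact (Suc p) * fact k / fact (Suc p + k + 1)"
    using Suc[of "Suc p"] by blast
  define G where "G u = u ^ Suc p * (1 - u) ^ Suc k / real (Suc p)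
                       + real (Suc k) / real (Suc p) * F u" for u
  have "(G has_real_derivative u ^ p * (1 - u) ^ Suc k) (at u)" for u
  proof -
    have "((\<lambda>u. u ^ Suc p * (1 - u) ^ Suc k / real (Suc p) + real (Suc k) / real (Suc p) * F u)
            has_real_derivative
            (real (Suc p) * u ^ p * (1 - u) ^ Suc k - u ^ Suc p * (real (Suc k) * (1 - u) ^ k)) / real (Suc p)
             + real (Suc k) / real (Suc p) * (u ^ Suc p * (1 - u) ^ k)) (at u)"
      by (rule derivative_eq_intros F refl | simp add: mult_ac del: of_nat_Suc power_Suc)+
    also have "(real (Suc p) * u ^ p * (1 - u) ^ Suc k - u ^ Suc p * (real (Suc k) * (1 - u) ^ k)) / real (Suc p)
             + real (Suc k) / real (Suc p) * (u ^ Suc p * (1 - u) ^ k) = u ^ p * (1 - u) ^ Suc k"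
      by (simp add: diff_divide_distrib del: of_nat_Suc power_Suc)
    finally show ?thesis unfolding G_def .
  qed
  moreover have "G 1 - G 0 = fact p * fact (Suc k) / fact (p + Suc k + 1)"
  proof -
    have "G 1 - G 0 = real (Suc k) / real (Suc p) * (F 1 - F 0)"
      by (simp add: G_def right_diff_distrib del: of_nat_Suc)
    also have "\<dots> = fact p * fact (Suc k) / fact (p + Suc k + 1)"
      unfolding F01 by (simp add: divide_simps del: of_nat_Suc) 
    finally show ?thesis .
  qed
  ultimately show ?case by blast
qed

text \<open>The substitution \<open>u = s / (1 + s)\<close> turns the integrand into \<open>u\<^sup>p (1 - u)\<^sup>k du\<close> on \<open>[0,1)\<close>.\<close>

lemma beta_integral_half_line:
  "has_bochner_integral lborel
     (\<lambda>s::real. indicator {0..} s * (s ^ p / (1 + s) ^ (p + k + 2)))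
     (fact p * fact k / fact (p + k + 1))"
proof -
  obtain F where F: "\<And>u::real. (F has_real_derivative u ^ p * (1 - u) ^ k) (at u)"
    and F01: "F 1 - F 0 = fact p * fact k / fact (p + k + 1)"
    using beta_antiderivative[of p k] by blast
  define f where "f s = s ^ p / (1 + s) ^ (p + k + 2)" for s :: real
  have DF: "((\<lambda>s. F (s / (1 + s))) has_real_derivative f s) (at s)" if "s \<ge> 0" for s
  proof -
    have 1: "((\<lambda>s. s / (1 + s)) has_real_derivative 1 / (1 + s)^2) (at s)"
      using that by (auto intro!: derivative_eq_intros simp: field_simps power2_eq_square)
    have 2: "1 - s / (1 + s) = 1 / (1 + s)" using that by (simp add: field_simps)
    have "((\<lambda>s. F (s / (1 + s))) has_real_derivative
            ((s / (1 + s)) ^ p * (1 - s / (1 + s)) ^ k) * (1 / (1 + s)^2)) (at s)"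
      by (rule DERIV_chain2[OF F 1])
    also have "((s / (1 + s)) ^ p * (1 - s / (1 + s)) ^ k) * (1 / (1 + s)^2) = f s"
      unfolding 2 f_def by (simp add: power_divide power_add power2_eq_square)
    finally show ?thesis .
  qed
  have lim: "((\<lambda>s. F (s / (1 + s))) \<longlongrightarrow> F 1) at_top"
  proof (rule isCont_tendsto_compose[where g = F and l = 1])
    show "isCont F 1" using F by (rule DERIV_isCont)
    show "((\<lambda>s::real. s / (1 + s)) \<longlongrightarrow> 1) at_top"
    proof (rule Lim_transform_eventually)
      show "((\<lambda>s::real. 1 - inverse (1 + s)) \<longlongrightarrow> 1) at_top"
        by (rule tendsto_eq_intros tendsto_inverse_0_at_top filterlim_tendsto_add_at_top
              filterlim_ident refl | simp)+
      show "\<forall>\<^sub>F s::real in at_top. 1 - inverse (1 + s) = s / (1 + s)"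
        using eventually_ge_at_top[of 0] by eventually_elim (simp add: field_simps)
    qed
  qed
  have meas: "f \<in> borel_measurable borel" unfolding f_def by measurable
  have nn: "(\<integral>\<^sup>+s. ennreal (f s) * indicator {0..} s \<partial>lborel) = ennreal (F 1 - F 0)"
    using nn_integral_FTC_atLeast[of f 0 "\<lambda>s. F (s / (1 + s))" "F 1"] DF lim meas
    by (simp add: f_def)
  have "has_bochner_integral lborel (\<lambda>s. indicator {0..} s * f s) (F 1 - F 0)"
  proof (rule has_bochner_integral_nn_integral)
    show "(\<lambda>s. indicator {0..} s * f s) \<in> borel_measurable lborel" using meas by measurable
    show "AE s in lborel. 0 \<le> indicator {0..} s * f s" by (auto simp: f_def indicator_def)
    show "0 \<le> F 1 - F 0" by (simp add: F01)
    show "(\<integral>\<^sup>+s. ennreal (indicator {0..} s * f s) \<partial>lborel) = ennreal (F 1 - F 0)"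
      unfolding nn[symmetric] by (intro nn_integral_cong) (auto simp: indicator_def)
  qed
  then show ?thesis unfolding f_def F01 .
qed

definition beta_prime_density :: "nat \<Rightarrow> nat \<Rightarrow> real \<Rightarrow> real" where
  "beta_prime_density N i s =
     indicator {0..} s * (fact (i + N + 1) / (fact i * fact N) * (s ^ i / (1 + s) ^ (i + N + 2)))"

text \<open>The law of the integration variable \<open>s\<close> in the \<open>r\<close>-th term of the operator with \<open>n = N + 2\<close>: the beta
  prime distribution with parameters \<open>r = i + 1\<close> and \<open>N + 1\<close>. For \<open>r = 0\<close> it degenerates to the point mass at \<open>0\<close>,
  which accounts for the separate summand with \<open>g(0)\<close>.\<close>

definition beta_prime :: "nat \<Rightarrow> nat \<Rightarrow> real measure" where
  "beta_prime N r = (case r of 0 \<Rightarrow> return borel 0 | Suc i \<Rightarrow> density lborel (beta_prime_density N i))"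

lemma beta_prime_density_nonneg: "beta_prime_density N i s \<ge> 0"
  by (auto simp: beta_prime_density_def indicator_def)

lemma borel_measurable_beta_prime_density [measurable]: "beta_prime_density N i \<in> borel_measurable borel"
  unfolding beta_prime_density_def by measurable

lemma sets_beta_prime [measurable_cong, simp]: "sets (beta_prime N r) = sets borel"
  by (cases r) (simp_all add: beta_prime_def)

lemma space_beta_prime [simp]: "space (beta_prime N r) = UNIV"
  by (cases r) (simp_all add: beta_prime_def)

lemma has_bochner_integral_beta_prime_Suc:
  fixes f :: "real \<Rightarrow> real"
  assumes "f \<in> borel_measurable borel"
    and "has_bochner_integral lborel (\<lambda>s. beta_prime_density N i s * f s) I"
  shows "has_bochner_integral (beta_prime N (Suc i)) f I"
  unfolding beta_prime_def nat.case
  using assms by (intro has_bochner_integral_density) (auto simp: beta_prime_density_nonneg)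

lemma has_bochner_integral_beta_prime_0:
  fixes f :: "real \<Rightarrow> real"
  assumes [measurable]: "f \<in> borel_measurable borel"
  shows "has_bochner_integral (beta_prime N 0) f (f 0)"
proof -
  interpret prob_space "return borel (0::real)" by (rule prob_space_return) simp
  have "has_bochner_integral (return borel 0) (\<lambda>_::real. f 0) (f 0)"
    using prob_space by (simp add: has_bochner_integral_iff)
  also have "has_bochner_integral (return borel 0) (\<lambda>_::real. f 0) (f 0)
             \<longleftrightarrow> has_bochner_integral (return borel 0) f (f 0)"
    by (intro has_bochner_integral_cong_AE) (auto simp: AE_return)
  finally show ?thesis by (simp add: beta_prime_def)
qed

text \<open>Multiplying the density by \<open>s\<^sup>j\<close> gives the beta integral with parameters shifted by \<open>j\<close>. The formula
  with the Pochhammer symbol covers the point mass \<open>r = 0\<close> as well.\<close>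

lemma beta_prime_moment:
  assumes "j \<le> N"
  shows "has_bochner_integral (beta_prime N r) (\<lambda>s. s ^ j)
           (pochhammer (real r) j * fact (N - j) / fact N)"
proof (cases r)
  case 0
  have "pochhammer (0::real) j * fact (N - j) / fact N = 0 ^ j"
    by (cases j) (simp_all add: pochhammer_rec)
  then show ?thesis using has_bochner_integral_beta_prime_0[of "\<lambda>s. s ^ j" N] 0 by simp
next
  case (Suc i)
  let ?c = "fact (i + N + 1) / (fact i * fact N) :: real"
  have "fact (i + j) = fact i * pochhammer (real (Suc i)) j"
    using pochhammer_product'[of "1::real" i j] by (simp add: pochhammer_fact add.commute)
  moreover have "(i + j) + (N - j) = i + N" using assms by simp
  moreover have "has_bochner_integral lborel
        (\<lambda>s. ?c * (indicator {0..} s * (s ^ (i + j) / (1 + s) ^ ((i + j) + (N - j) + 2))))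
        (?c * (fact (i + j) * fact (N - j) / fact ((i + j) + (N - j) + 1)))"
    by (intro has_bochner_integral_mult_right beta_integral_half_line)
  ultimately have "has_bochner_integral lborel
        (\<lambda>s. ?c * (indicator {0..} s * (s ^ (i + j) / (1 + s) ^ (i + N + 2))))
        (pochhammer (real (Suc i)) j * fact (N - j) / fact N)"
    by simp
  then have "has_bochner_integral lborel (\<lambda>s. beta_prime_density N i s * s ^ j)
        (pochhammer (real (Suc i)) j * fact (N - j) / fact N)"
    by (simp add: beta_prime_density_def power_add mult_ac)
  then show ?thesis unfolding Suc by (intro has_bochner_integral_beta_prime_Suc) auto
qed

lemma prob_space_beta_prime: "prob_space (beta_prime N r)"
proof -
  have "has_bochner_integral (beta_prime N r) (\<lambda>s. 1 :: real) 1"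
    using beta_prime_moment[of 0 N r] by simp
  then have "(\<integral>\<^sup>+s. ennreal 1 \<partial>beta_prime N r) = ennreal 1"
    using nn_integral_eq_integral[of "beta_prime N r" "\<lambda>s. 1"] by (simp add: has_bochner_integral_iff)
  then show ?thesis by (intro prob_spaceI) simp
qed

lemma AE_beta_prime_nonneg: "AE s in beta_prime N r. s \<ge> 0"
proof (cases r)
  case 0
  have "AE s in return borel (0::real). s \<ge> 0" by (subst AE_return) auto
  then show ?thesis unfolding 0 beta_prime_def nat.case .
next
  case (Suc i)
  have "AE s in density lborel (beta_prime_density N i). s \<ge> 0"
    by (subst AE_density) (auto simp: beta_prime_density_def indicator_def)
  then show ?thesis unfolding Suc beta_prime_def nat.case .
qed

text \<open>The mean is \<open>m r\<close>; the fourth power is expanded and the moments up to order four are inserted.\<close>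

lemma beta_prime_central_moment4:
  assumes "N \<ge> 4"
  defines "m \<equiv> \<lambda>r::nat. real r / real N"
  shows "has_bochner_integral (beta_prime N r) (\<lambda>s. (s - m r) ^ 4)
     (3 * m r * (1 + m r) * (m r * (1 + m r) * (real N - 2) + 2 * (1 + 2 * m r)\<^sup>2) /
      ((real N - 1) * (real N - 2) * (real N - 3)))"
proof -
  define \<mu> where "\<mu> j = pochhammer (real r) j * fact (N - j) / fact N" for j
  define a where "a = m r"
  have r: "real r = a * real N" using assms(1) by (simp add: a_def m_def)
  define k where "k = N - 4"
  have N: "N = k + 4" using assms(1) by (simp add: k_def)
  have \<mu>: "\<mu> 0 = 1" "\<mu> 1 = a" "\<mu> 2 = a * (a * real N + 1) / (real N - 1)"
    "\<mu> 3 = a * (a * real N + 1) * (a * real N + 2) / ((real N - 1) * (real N - 2))"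
    "\<mu> 4 = a * (a * real N + 1) * (a * real N + 2) * (a * real N + 3) /
            ((real N - 1) * (real N - 2) * (real N - 3))"
  proof -
    have f: "fact (N - j) / fact N * (\<Prod>i<j. real N - real i) = 1" if "j \<le> 4" for j
      using that
    proof (induction j)
      case (Suc j)
      have "N - j = Suc (N - Suc j)" "real (N - j) = real N - real j" using Suc.prems N by auto
      then have "fact (N - j) = (real N - real j) * fact (N - Suc j)"
        by (metis fact_Suc of_nat_fact of_nat_mult)
      then show ?case using Suc N by (simp add: mult_ac)
    qed simp
    have \<mu>': "\<mu> j = pochhammer (a * real N) j / (\<Prod>i<j. real N - real i)" if "j \<le> 4" for j
    proof -
      have "(\<Prod>i<j. real N - real i) \<noteq> 0" using that N by (auto simp: prod_zero_iff)
      then show ?thesis using f[OF that] unfolding \<mu>_def r by (simp add: field_simps)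
    qed
    have p: "pochhammer x 1 = x" "pochhammer x 2 = x * (x + 1)" "pochhammer x 3 = x * (x + 1) * (x + 2)"
      "pochhammer x 4 = x * (x + 1) * (x + 2) * (x + 3)" for x :: real
      by (simp_all add: pochhammer_Suc eval_nat_numeral add_ac)
    have d: "(\<Prod>i<1. x - real i) = x" "(\<Prod>i<2. x - real i) = x * (x - 1)"
      "(\<Prod>i<3. x - real i) = x * ((x - 1) * (x - 2))"
      "(\<Prod>i<4. x - real i) = x * ((x - 1) * (x - 2) * (x - 3))" for x :: real
      by (simp_all add: prod.lessThan_Suc eval_nat_numeral)
    have N0: "real N \<noteq> 0" using N by simp
    have c: "a * real N * b * e * h / (real N * g) = a * b * e * h / g" for b e g h
      using N0 by simp
    show "\<mu> 0 = 1" using \<mu>'[of 0] by simp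
    show "\<mu> 1 = a" using \<mu>'[of 1] N0 unfolding p d by simp
    show "\<mu> 2 = a * (a * real N + 1) / (real N - 1)"
      using \<mu>'[of 2] c[of _ 1 1] unfolding p d by simp
    show "\<mu> 3 = a * (a * real N + 1) * (a * real N + 2) / ((real N - 1) * (real N - 2))"
      using \<mu>'[of 3] c[of _ _ 1] unfolding p d by simp
    show "\<mu> 4 = a * (a * real N + 1) * (a * real N + 2) * (a * real N + 3) /
            ((real N - 1) * (real N - 2) * (real N - 3))"
      using \<mu>'[of 4] unfolding p d c by simp
  qed
  have M: "has_bochner_integral (beta_prime N r) (\<lambda>s. s ^ j) (\<mu> j)" if "j \<le> 4" for j
    unfolding \<mu>_def using that assms(1) by (intro beta_prime_moment) simp
  have "has_bochner_integral (beta_prime N r)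
      (\<lambda>s. s ^ 4 + (- 4 * a) * s ^ 3 + (6 * a\<^sup>2) * s ^ 2 + (- 4 * a ^ 3) * s ^ 1 + (a ^ 4) * s ^ 0)
      (\<mu> 4 + (- 4 * a) * \<mu> 3 + (6 * a\<^sup>2) * \<mu> 2 + (- 4 * a ^ 3) * \<mu> 1 + (a ^ 4) * \<mu> 0)"
    by (intro has_bochner_integral_add has_bochner_integral_mult_right M) simp_all
  moreover have "(\<lambda>s. s ^ 4 + (- 4 * a) * s ^ 3 + (6 * a\<^sup>2) * s ^ 2 + (- 4 * a ^ 3) * s ^ 1 + (a ^ 4) * s ^ 0)
      = (\<lambda>s. (s - a) ^ 4)"
    by (rule ext) (simp add: eval_nat_numeral algebra_simps)
  moreover have "\<mu> 4 + (- 4 * a) * \<mu> 3 + (6 * a\<^sup>2) * \<mu> 2 + (- 4 * a ^ 3) * \<mu> 1 + (a ^ 4) * \<mu> 0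
      = 3 * a * (1 + a) * (a * (1 + a) * (real N - 2) + 2 * (1 + 2 * a)\<^sup>2) /
      ((real N - 1) * (real N - 2) * (real N - 3))"
  proof -
    \<comment> \<open>Over the common denominator \<open>D\<close> the claim becomes a polynomial identity in \<open>a\<close> and \<open>q = N - 3\<close>.\<close>
    define q where "q = real k + 1"
    define D where "D = (q + 2) * (q + 1) * q"
    have q: "real N = q + 3" "q > 0" by (simp_all add: q_def N)
    have nz: "q \<noteq> 0" "q + 1 \<noteq> 0" "q + 2 \<noteq> 0" "D \<noteq> 0" using q(2) by (auto simp: D_def)
    have N': "real N - 1 = q + 2" "real N - 2 = q + 1" "real N - 3 = q" by (simp_all add: q)
    have "\<mu> 4 = a * (a * real N + 1) * (a * real N + 2) * (a * real N + 3) / D"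
      "\<mu> 3 = a * (a * real N + 1) * (a * real N + 2) * q / D"
      "\<mu> 2 = a * (a * real N + 1) * ((q + 1) * q) / D" "\<mu> 1 = a * D / D" "\<mu> 0 = D / D"
      unfolding \<mu> N' using nz(1-3) by (simp_all add: D_def)
    then have "\<mu> 4 + (- 4 * a) * \<mu> 3 + (6 * a\<^sup>2) * \<mu> 2 + (- 4 * a ^ 3) * \<mu> 1 + (a ^ 4) * \<mu> 0
      = (a * (a * real N + 1) * (a * real N + 2) * (a * real N + 3)
         + (- 4 * a) * (a * (a * real N + 1) * (a * real N + 2) * q)
         + (6 * a\<^sup>2) * (a * (a * real N + 1) * ((q + 1) * q))
         + (- 4 * a ^ 3) * (a * D) + (a ^ 4) * D) / D"
      by (simp only: add_divide_distrib times_divide_eq_right)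
    also have "\<dots> = 3 * a * (1 + a) * (a * (1 + a) * (q + 1) + 2 * (1 + 2 * a)\<^sup>2) / D"
      unfolding q(1) D_def by (rule arg_cong2[where f = divide]) (simp_all add: eval_nat_numeral algebra_simps)
    finally show ?thesis unfolding N' D_def .
  qed
  ultimately show ?thesis unfolding a_def by simp
qed

text \<open>The exact value has order \<open>(1 + m)\<^sup>4 / n\<^sup>2\<close> with \<open>m = r / N\<close> and \<open>n = N + 2\<close>. The constant is dictated by the
  worst case \<open>N = 5\<close>, where \<open>3 (N + 6) (N + 2)\<^sup>2 / ((N - 1) (N - 2) (N - 3))\<close> equals \<open>67.375\<close>.\<close>

lemma beta_prime_central_moment4_le:
  assumes "N \<ge> 5"
  shows "integrable (beta_prime N r) (\<lambda>s. (s - real r / real N) ^ 4)"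
    and "(\<integral>s. (s - real r / real N) ^ 4 \<partial>beta_prime N r)
           \<le> 69 * (1 + real r / real N) ^ 4 / (real N + 2)\<^sup>2"
proof -
  define a where "a = real r / real N"
  have a: "a \<ge> 0" by (simp add: a_def)
  \<comment> \<open>Writing \<open>N = 5 + j\<close> makes all coefficients of the cubic inequality in \<open>j\<close> below nonnegative.\<close>
  define k where "k = N - 5"
  have N: "N = k + 5" using assms by (simp add: k_def)
  define j where "j = real k"
  have j: "real N = j + 5" "j \<ge> 0" by (simp_all add: j_def N)
  note * = beta_prime_central_moment4[of N r, folded a_def]
  show "integrable (beta_prime N r) (\<lambda>s. (s - real r / real N) ^ 4)"
    using * assms by (simp add: has_bochner_integral_iff a_def)
  have "(\<integral>s. (s - a) ^ 4 \<partial>beta_prime N r)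
       = 3 * a * (1 + a) * (a * (1 + a) * (real N - 2) + 2 * (1 + 2 * a)\<^sup>2) /
      ((real N - 1) * (real N - 2) * (real N - 3))"
    using * assms by (simp add: has_bochner_integral_iff)
  also have "\<dots> \<le> 3 * (1 + a)\<^sup>2 * ((1 + a)\<^sup>2 * (real N + 6)) / ((real N - 1) * (real N - 2) * (real N - 3))"
  proof -
    have "a * (1 + a) \<le> (1 + a)\<^sup>2" using a by (simp add: power2_eq_square algebra_simps)
    moreover have "a * (1 + a) * (real N - 2) + 2 * (1 + 2 * a)\<^sup>2 \<le> (1 + a)\<^sup>2 * (real N - 2) + 2 * (2 * (1 + a))\<^sup>2"
      using a j calculation by (intro add_mono mult_right_mono mult_left_mono power_mono) auto
    moreover have "(1 + a)\<^sup>2 * (real N - 2) + 2 * (2 * (1 + a))\<^sup>2 = (1 + a)\<^sup>2 * (real N + 6)"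
      by (simp add: power2_eq_square algebra_simps)
    moreover have "0 \<le> a * (1 + a) * (real N - 2) + 2 * (1 + 2 * a)\<^sup>2" using a j by simp
    ultimately have "3 * (a * (1 + a)) * (a * (1 + a) * (real N - 2) + 2 * (1 + 2 * a)\<^sup>2)
        \<le> 3 * (1 + a)\<^sup>2 * ((1 + a)\<^sup>2 * (real N + 6))"
      using a by (intro mult_mono) auto
    then show ?thesis using j by (intro divide_right_mono) (auto simp: mult.assoc)
  qed
  also have "\<dots> \<le> 69 * (1 + a) ^ 4 / (real N + 2)\<^sup>2"
  proof -
    have "(j + 11) * (j + 7)\<^sup>2 \<le> 23 * ((j + 4) * (j + 3) * (j + 2))"
    proof -
      have "23 * ((j + 4) * (j + 3) * (j + 2)) - (j + 11) * (j + 7)\<^sup>2 = 13 + 395 * j + 182 * j\<^sup>2 + 22 * j ^ 3"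
        by (simp add: power2_eq_square power3_eq_cube algebra_simps)
      also have "\<dots> \<ge> 0" using j(2) by simp
      finally show ?thesis by linarith
    qed
    moreover have "u / D \<le> 23 / E" if "u * E \<le> 23 * D" "D > 0" "E > 0" for u D E :: real
      using that by (simp add: field_simps)
    ultimately have "(j + 11) / ((j + 4) * (j + 3) * (j + 2)) \<le> 23 / (j + 7)\<^sup>2"
      using j(2) by simp
    then have "(real N + 6) / ((real N - 1) * (real N - 2) * (real N - 3)) \<le> 23 / (real N + 2)\<^sup>2"
      by (simp add: j(1) add_ac)
    then have "(3 * (1 + a) ^ 4) * ((real N + 6) / ((real N - 1) * (real N - 2) * (real N - 3)))
         \<le> (3 * (1 + a) ^ 4) * (23 / (real N + 2)\<^sup>2)"
      by (intro mult_left_mono) auto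
    moreover have "(1 + a)\<^sup>2 * (1 + a)\<^sup>2 = (1 + a) ^ 4" by (simp flip: power_add)
    ultimately show ?thesis by (simp add: mult.assoc)
  qed
  finally show "(\<integral>s. (s - real r / real N) ^ 4 \<partial>beta_prime N r)
           \<le> 69 * (1 + real r / real N) ^ 4 / (real N + 2)\<^sup>2" unfolding a_def .
qed

section \<open>Moments of the mixing weights\<close>

text \<open>The quotients \<open>\<gamma>\<^sub>\<nu>(r) / \<gamma>\<^sub>\<nu>(r - 1)\<close>, which replace the factors \<open>r\<close> of the ordinary factorial;
  the value at \<open>r = 0\<close> is \<open>0\<close>, so that the shift of the summation index below has no boundary term.\<close>

definition dunkl_step :: "real \<Rightarrow> nat \<Rightarrow> real" where
  "dunkl_step \<nu> r = real r + (if odd r then 2 * \<nu> else 0)"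

lemma dunkl_gamma_0 [simp]:
  assumes "\<nu> \<ge> 0"
  shows "dunkl_gamma \<nu> 0 = 1"
proof -
  have "Gamma (\<nu> + 1/2) > 0" using assms by (intro Gamma_real_pos) simp
  then show ?thesis by (simp add: dunkl_gamma_def)
qed

lemma dunkl_gamma_Suc:
  assumes "\<nu> \<ge> 0"
  shows "dunkl_gamma \<nu> (Suc r) = dunkl_step \<nu> (Suc r) * dunkl_gamma \<nu> r"
proof (cases "even r")
  case True
  then obtain k where r: "r = 2 * k" by blast
  have eq: "Gamma (real k + \<nu> + 3/2) = (real k + \<nu> + 1/2) * Gamma (real k + \<nu> + 1/2)"
    using Gamma_plus1[of "real k + \<nu> + 1/2"] assms
    by (simp add: add.assoc nonpos_Ints_def)
  then show ?thesis
    unfolding dunkl_gamma_def dunkl_step_def Let_def r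
    by (simp add: eq)
next
  case False
  then obtain k where r: "r = Suc (2 * k)" by (metis oddE Suc_eq_plus1)
  have "real (Suc k) + \<nu> + 1/2 = real k + \<nu> + 3/2" by simp
  then show ?thesis
    unfolding dunkl_gamma_def dunkl_step_def Let_def r
    by (simp add: field_simps)
qed

lemma dunkl_step_bounds:
  assumes "\<nu> \<ge> 0"
  shows "real r \<le> dunkl_step \<nu> r" "dunkl_step \<nu> r \<le> real r + 2 * \<nu>"
  using assms by (auto simp: dunkl_step_def)

lemma fact_le_dunkl_gamma:
  assumes "\<nu> \<ge> 0"
  shows "fact r \<le> dunkl_gamma \<nu> r"
proof (induction r)
  case (Suc r)
  have "real (Suc r) * fact r \<le> dunkl_step \<nu> (Suc r) * dunkl_gamma \<nu> r"
    using assms by (intro mult_mono Suc dunkl_step_bounds) (auto simp: dunkl_step_def)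
  then show ?case using assms by (simp add: dunkl_gamma_Suc)
qed (use assms in simp)

text \<open>The unnormalised mixing weights. Dividing by their sum \<open>e\<^sub>\<nu>(y)\<close> gives a probability
  distribution on the natural numbers, the Poisson distribution with mean \<open>y\<close> when \<open>\<nu> = 0\<close>.\<close>

definition dunkl_weight :: "real \<Rightarrow> real \<Rightarrow> nat \<Rightarrow> real" where
  "dunkl_weight \<nu> y r = y ^ r / dunkl_gamma \<nu> r"

lemma dunkl_gamma_pos: "\<nu> \<ge> 0 \<Longrightarrow> dunkl_gamma \<nu> r > 0"
  using fact_le_dunkl_gamma[of \<nu> r] fact_gt_zero[of r, where 'a = real] by linarith

lemma dunkl_weight_nonneg: "\<nu> \<ge> 0 \<Longrightarrow> y \<ge> 0 \<Longrightarrow> dunkl_weight \<nu> y r \<ge> 0"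
  using dunkl_gamma_pos[of \<nu> r] by (simp add: dunkl_weight_def)

text \<open>Since \<open>\<gamma>\<^sub>\<nu>(r) \<ge> r!\<close> and \<open>(r + 1)\<^sup>4 \<le> 24 e\<^sup>r\<^sup>+\<^sup>1\<close>, the exponential series at \<open>e y\<close> is a majorant.\<close>

lemma summable_dunkl_weight:
  fixes f :: "nat \<Rightarrow> real"
  assumes "\<nu> \<ge> 0" "y \<ge> 0" and f: "\<And>r. \<bar>f r\<bar> \<le> C * (real r + 1) ^ 4"
  shows "summable (\<lambda>r. dunkl_weight \<nu> y r * f r)"
proof (rule summable_comparison_test')
  have C: "C \<ge> 0" using f[of 0] by simp
  show "summable (\<lambda>r. 24 * exp 1 * C * (inverse (fact r) * (exp 1 * y) ^ r))"
    by (intro summable_mult summable_exp)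
  show "norm (dunkl_weight \<nu> y r * f r) \<le> 24 * exp 1 * C * (inverse (fact r) * (exp 1 * y) ^ r)" for r
  proof -
    have "(real r + 1) ^ 4 / fact 4 \<le> exp (real r + 1)"
      using sum_le_suminf[OF summable_exp[of "real r + 1"], of "{4}"]
      by (simp add: exp_def divide_inverse mult.commute)
    then have "(real r + 1) ^ 4 \<le> 24 * (exp 1 * exp 1 ^ r)"
      by (simp add: fact_numeral exp_add exp_of_nat_mult[symmetric] mult.commute)
    then have "\<bar>f r\<bar> \<le> C * (24 * (exp 1 * exp 1 ^ r))"
      using f[of r] C by (meson mult_left_mono order_trans)
    moreover have "dunkl_weight \<nu> y r \<le> y ^ r / fact r"
      unfolding dunkl_weight_def using assms fact_le_dunkl_gamma[of \<nu> r]
      by (intro divide_left_mono) (auto intro!: mult_pos_pos dunkl_gamma_pos)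
    ultimately have "dunkl_weight \<nu> y r * \<bar>f r\<bar> \<le> (y ^ r / fact r) * (C * (24 * (exp 1 * exp 1 ^ r)))"
      using assms by (intro mult_mono) auto
    then show ?thesis
      using dunkl_weight_nonneg[OF assms(1,2), of r]
      by (simp add: abs_mult power_mult_distrib field_simps)
  qed
qed

lemma suminf_dunkl_weight:
  assumes "\<nu> \<ge> 0" "y \<ge> 0"
  shows "suminf (dunkl_weight \<nu> y) = dunkl_exp \<nu> y" "summable (dunkl_weight \<nu> y)" "dunkl_exp \<nu> y \<ge> 1"
proof -
  show *: "summable (dunkl_weight \<nu> y)"
    using summable_dunkl_weight[OF assms, of "\<lambda>_. 1" 1] by simp
  show e: "suminf (dunkl_weight \<nu> y) = dunkl_exp \<nu> y"
    by (simp add: dunkl_exp_def dunkl_weight_def[abs_def])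
  have "sum (dunkl_weight \<nu> y) {0} \<le> suminf (dunkl_weight \<nu> y)"
    using * assms by (intro sum_le_suminf) (auto intro: dunkl_weight_nonneg)
  then show "dunkl_exp \<nu> y \<ge> 1"
    using assms by (simp add: e) (simp add: dunkl_weight_def)
qed

text \<open>The analogue of \<open>E (r f r) = y E (f (r + 1))\<close> for the Poisson distribution: the factor
  \<open>dunkl_step \<nu> r\<close> cancels the last factor of \<open>\<gamma>\<^sub>\<nu>(r)\<close>, and the term \<open>r = 0\<close> vanishes.\<close>

lemma dunkl_weight_shift:
  fixes f :: "nat \<Rightarrow> real"
  assumes "\<nu> \<ge> 0" "y \<ge> 0"
    and "summable (\<lambda>r. dunkl_weight \<nu> y r * (dunkl_step \<nu> r * f r))"
  shows "(\<Sum>r. dunkl_weight \<nu> y r * (dunkl_step \<nu> r * f r)) = y * (\<Sum>r. dunkl_weight \<nu> y r * f (Suc r))"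
proof -
  have shift: "dunkl_weight \<nu> y (Suc r) * (dunkl_step \<nu> (Suc r) * f (Suc r))
               = y * (dunkl_weight \<nu> y r * f (Suc r))" for r
  proof -
    have "dunkl_step \<nu> (Suc r) > 0" using dunkl_step_bounds(1)[OF assms(1), of "Suc r"] by simp
    then show ?thesis using assms dunkl_gamma_pos[of \<nu> r]
      by (simp add: dunkl_weight_def dunkl_gamma_Suc)
  qed
  have "(\<Sum>r. dunkl_weight \<nu> y r * (dunkl_step \<nu> r * f r))
        = (\<Sum>r. dunkl_weight \<nu> y (Suc r) * (dunkl_step \<nu> (Suc r) * f (Suc r)))"
    using suminf_split_head[OF assms(3)] by (simp add: dunkl_step_def)
  also have "\<dots> = (\<Sum>r. y * (dunkl_weight \<nu> y r * f (Suc r)))" by (simp only: shift)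
  also have "\<dots> = y * (\<Sum>r. dunkl_weight \<nu> y r * f (Suc r))"
  proof (cases "y = 0")
    case False
    have "summable (\<lambda>r. y * (dunkl_weight \<nu> y r * f (Suc r)))"
      using assms(3) unfolding shift[symmetric] by (subst summable_Suc_iff)
    then show ?thesis using False by (intro suminf_mult) (simp add: summable_cmult_iff)
  qed simp
  finally show ?thesis .
qed

lemma summable_dunkl_weight_step:
  fixes f :: "nat \<Rightarrow> real"
  assumes "\<nu> \<ge> 0" "y \<ge> 0" and f: "\<And>r. \<bar>f r\<bar> \<le> C * (real r + 1) ^ 3"
  shows "summable (\<lambda>r. dunkl_weight \<nu> y r * (dunkl_step \<nu> r * f r))"
proof (rule summable_dunkl_weight[OF assms(1,2)])
  fix r
  have "\<bar>dunkl_step \<nu> r\<bar> \<le> real r + 2 * \<nu>"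
    using dunkl_step_bounds[OF assms(1), of r] by linarith
  also have "\<dots> \<le> (1 + 2 * \<nu>) * (real r + 1)" using assms(1) by (simp add: algebra_simps)
  finally have "\<bar>dunkl_step \<nu> r\<bar> * \<bar>f r\<bar> \<le> ((1 + 2 * \<nu>) * (real r + 1)) * (C * (real r + 1) ^ 3)"
    using f assms(1) by (intro mult_mono) auto
  then show "\<bar>dunkl_step \<nu> r * f r\<bar> \<le> ((1 + 2 * \<nu>) * C) * (real r + 1) ^ 4"
    by (simp add: abs_mult eval_nat_numeral mult_ac)
qed

text \<open>Stein's identity for the mixing weights. It lowers the degree in \<open>dunkl_step \<nu> r - y\<close>: if \<open>f\<close> is a
  power of it, the difference on the right has one degree less, with coefficients bounded by the
  increments of \<open>dunkl_step\<close>. This gives the moments without computing them in closed form.\<close>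

lemma dunkl_stein_identity:
  fixes f :: "nat \<Rightarrow> real"
  assumes "\<nu> \<ge> 0" "y \<ge> 0" and f: "\<And>r. \<bar>f r\<bar> \<le> C * (real r + 1) ^ 3"
  shows "(\<Sum>r. dunkl_weight \<nu> y r * ((dunkl_step \<nu> r - y) * f r))
       = y * (\<Sum>r. dunkl_weight \<nu> y r * (f (Suc r) - f r))"
proof -
  have C: "C \<ge> 0" using f[of 0] by simp
  have s1: "summable (\<lambda>r. dunkl_weight \<nu> y r * (dunkl_step \<nu> r * f r))"
    by (rule summable_dunkl_weight_step[OF assms])
  have s2: "summable (\<lambda>r. dunkl_weight \<nu> y r * f r)"
  proof (rule summable_dunkl_weight[OF assms(1,2)])
    show "\<bar>f r\<bar> \<le> C * (real r + 1) ^ 4" for r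
      using f[of r] C mult_left_mono[OF power_increasing[of 3 4 "real r + 1"], of C] by simp
  qed
  have s3: "summable (\<lambda>r. dunkl_weight \<nu> y r * f (Suc r))"
  proof (rule summable_dunkl_weight[OF assms(1,2)])
    show "\<bar>f (Suc r)\<bar> \<le> (8 * C) * (real r + 1) ^ 4" for r
    proof -
      have "\<bar>f (Suc r)\<bar> \<le> C * (real (Suc r) + 1) ^ 3" by (rule f)
      also have "\<dots> \<le> C * (2 * (real r + 1)) ^ 3"
        using C by (intro mult_left_mono power_mono) auto
      also have "\<dots> = (8 * C) * (real r + 1) ^ 3" by (simp only: power_mult_distrib) simp
      also have "\<dots> \<le> (8 * C) * (real r + 1) ^ 4"
        using C by (intro mult_left_mono power_increasing) auto
      finally show ?thesis .
    qed
  qed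
  have "(\<Sum>r. dunkl_weight \<nu> y r * ((dunkl_step \<nu> r - y) * f r))
      = (\<Sum>r. dunkl_weight \<nu> y r * (dunkl_step \<nu> r * f r) - y * (dunkl_weight \<nu> y r * f r))"
    by (simp add: algebra_simps)
  also have "\<dots> = y * (\<Sum>r. dunkl_weight \<nu> y r * f (Suc r)) - y * (\<Sum>r. dunkl_weight \<nu> y r * f r)"
    using s1 s2 by (simp add: suminf_diff[symmetric] summable_mult suminf_mult dunkl_weight_shift[OF assms(1,2) s1])
  also have "\<dots> = y * (\<Sum>r. dunkl_weight \<nu> y r * f (Suc r) - dunkl_weight \<nu> y r * f r)"
    using s2 s3 by (simp add: suminf_diff[symmetric] right_diff_distrib)
  finally show ?thesis by (simp add: right_diff_distrib)
qed

lemma dunkl_step_diff_bound: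
  assumes "\<nu> \<ge> 0"
  shows "\<bar>dunkl_step \<nu> (Suc r) - dunkl_step \<nu> r\<bar> \<le> 1 + 2 * \<nu>"
  using assms by (auto simp: dunkl_step_def)

text \<open>A crude bound, only for summability.\<close>

lemma dunkl_deviation_bound:
  assumes "\<nu> \<ge> 0" "y \<ge> 0"
  shows "\<bar>dunkl_step \<nu> r - y\<bar> ^ k \<le> (1 + 2 * \<nu> + y) ^ k * (real r + 1) ^ k"
proof -
  have "\<bar>dunkl_step \<nu> r - y\<bar> \<le> real r + 2 * \<nu> + y"
    using dunkl_step_bounds[OF assms(1), of r] assms by linarith
  also have "\<dots> \<le> (1 + 2 * \<nu> + y) * (real r + 1)" using assms by (simp add: algebra_simps)
  finally show ?thesis unfolding power_mult_distrib[symmetric] by (intro power_mono) auto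
qed

lemma summable_dunkl_moment:
  assumes "\<nu> \<ge> 0" "y \<ge> 0" "k \<le> 4"
  shows "summable (\<lambda>r. dunkl_weight \<nu> y r * (dunkl_step \<nu> r - y) ^ k)"
proof (rule summable_dunkl_weight[OF assms(1,2)])
  fix r
  have "\<bar>(dunkl_step \<nu> r - y) ^ k\<bar> \<le> (1 + 2 * \<nu> + y) ^ k * (real r + 1) ^ k"
    using dunkl_deviation_bound[OF assms(1,2)] by (simp add: power_abs)
  also have "\<dots> \<le> (1 + 2 * \<nu> + y) ^ k * (real r + 1) ^ 4"
    using assms by (intro mult_left_mono power_increasing) auto
  finally show "\<bar>(dunkl_step \<nu> r - y) ^ k\<bar> \<le> (1 + 2 * \<nu> + y) ^ k * (real r + 1) ^ 4" .
qed

text \<open>Stein's identity with \<open>f r = dunkl_step \<nu> r - y\<close>.\<close>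

lemma dunkl_second_moment:
  assumes "\<nu> \<ge> 0" "y \<ge> 0"
  shows "(\<Sum>r. dunkl_weight \<nu> y r * (dunkl_step \<nu> r - y)\<^sup>2) \<le> (1 + 2 * \<nu>) * y * dunkl_exp \<nu> y"
proof -
  let ?w = "dunkl_weight \<nu> y" and ?a = "dunkl_step \<nu>"
  have bnd: "\<bar>?a r - y\<bar> \<le> (1 + 2 * \<nu> + y) * (real r + 1) ^ 3" for r
  proof -
    have "\<bar>?a r - y\<bar> \<le> (1 + 2 * \<nu> + y) * (real r + 1)"
      using dunkl_deviation_bound[OF assms, of r 1] by simp
    also have "\<dots> \<le> (1 + 2 * \<nu> + y) * (real r + 1) ^ 3"
      using assms self_le_power[of "real r + 1" 3] by (intro mult_left_mono) auto
    finally show ?thesis .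
  qed
  have "(\<Sum>r. ?w r * (?a r - y)\<^sup>2) = y * (\<Sum>r. ?w r * ((?a (Suc r) - y) - (?a r - y)))"
    using dunkl_stein_identity[OF assms bnd] by (simp add: power2_eq_square)
  also have "\<dots> = y * (\<Sum>r. ?w r * (?a (Suc r) - ?a r))" by simp
  also have "\<dots> \<le> y * (\<Sum>r. (1 + 2 * \<nu>) * ?w r)"
  proof (rule mult_left_mono[OF suminf_le])
    show "0 \<le> y" by (rule assms)
    show "?w r * (?a (Suc r) - ?a r) \<le> (1 + 2 * \<nu>) * ?w r" for r
      using dunkl_step_diff_bound[OF assms(1), of r] dunkl_weight_nonneg[OF assms, of r]
      by (subst mult.commute) (intro mult_right_mono, auto)
    show "summable (\<lambda>r. ?w r * (?a (Suc r) - ?a r))"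
    proof (rule summable_dunkl_weight[OF assms])
      show "\<bar>?a (Suc r) - ?a r\<bar> \<le> (1 + 2 * \<nu>) * (real r + 1) ^ 4" for r
      proof -
        have "\<bar>?a (Suc r) - ?a r\<bar> \<le> (1 + 2 * \<nu>) * 1"
          using dunkl_step_diff_bound[OF assms(1), of r] by simp
        also have "\<dots> \<le> (1 + 2 * \<nu>) * (real r + 1) ^ 4"
          using assms by (intro mult_left_mono one_le_power) auto
        finally show ?thesis .
      qed
    qed
    show "summable (\<lambda>r. (1 + 2 * \<nu>) * ?w r)"
      by (intro summable_mult suminf_dunkl_weight assms)
  qed
  also have "(\<Sum>r. (1 + 2 * \<nu>) * ?w r) = (1 + 2 * \<nu>) * dunkl_exp \<nu> y"
    using suminf_dunkl_weight[OF assms] by (simp add: suminf_mult)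
  finally show ?thesis by (simp add: mult_ac)
qed

text \<open>Stein's identity with the cube: writing \<open>d\<close> for the deviation and \<open>b\<close> for the increment of
  \<open>dunkl_step\<close>, the difference \<open>(d + b)\<^sup>3 - d\<^sup>3\<close> is at most quadratic in \<open>d\<close>, so the second moment
  suffices.\<close>

lemma dunkl_fourth_moment:
  assumes "\<nu> \<ge> 0" "y \<ge> 0"
  shows "(\<Sum>r. dunkl_weight \<nu> y r * (dunkl_step \<nu> r - y) ^ 4)
           \<le> 6 * (1 + 2 * \<nu>) ^ 3 * (y\<^sup>2 + y) * dunkl_exp \<nu> y"
proof -
  let ?w = "dunkl_weight \<nu> y" and ?a = "dunkl_step \<nu>" and ?e = "dunkl_exp \<nu> y"
  define c where "c = 1 + 2 * \<nu>"
  have c: "c \<ge> 1" using assms by (simp add: c_def)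
  have diff: "((?a (Suc r) - y) ^ 3 - (?a r - y) ^ 3) \<le> 6 * c\<^sup>2 * (?a r - y)\<^sup>2 + 4 * c ^ 3" for r
  proof -
    define d b where "d = ?a r - y" and "b = ?a (Suc r) - ?a r"
    have b: "\<bar>b\<bar> \<le> c" using dunkl_step_diff_bound[OF assms(1)] by (simp add: b_def c_def)
    have b2: "b\<^sup>2 \<le> c\<^sup>2" using b c by (simp add: abs_le_square_iff[symmetric])
    have b3: "b ^ 3 \<le> c ^ 3" using b by (intro power_mono_odd) auto
    have cc: "c \<le> c\<^sup>2" "c\<^sup>2 \<le> c ^ 3" using c by (auto intro: self_le_power power_increasing)
    have "(?a (Suc r) - y) ^ 3 - d ^ 3 = 3 * (b * d\<^sup>2) + 3 * (b\<^sup>2 * d) + b ^ 3"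
      by (simp add: b_def d_def eval_nat_numeral algebra_simps)
    moreover have "b * d\<^sup>2 \<le> c\<^sup>2 * d\<^sup>2" using b cc by (intro mult_right_mono) auto
    moreover have "b\<^sup>2 * d \<le> c\<^sup>2 * (1 + d\<^sup>2)"
    proof -
      have "d \<le> 1 + d\<^sup>2" using zero_le_power2[of "d - 1/2"] by (simp add: power2_eq_square algebra_simps)
      then have "b\<^sup>2 * d \<le> b\<^sup>2 * (1 + d\<^sup>2)" by (intro mult_left_mono) auto
      also have "\<dots> \<le> c\<^sup>2 * (1 + d\<^sup>2)" using b2 by (intro mult_right_mono) auto
      finally show ?thesis .
    qed
    ultimately have "(?a (Suc r) - y) ^ 3 - d ^ 3 \<le> 6 * (c\<^sup>2 * d\<^sup>2) + 4 * c ^ 3"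
      using b3 cc by (simp add: distrib_left)
    then show ?thesis by (simp add: d_def)
  qed
  have bnd: "\<bar>(?a r - y) ^ 3\<bar> \<le> (1 + 2 * \<nu> + y) ^ 3 * (real r + 1) ^ 3" for r
    using dunkl_deviation_bound[OF assms, of r 3] by (simp add: power_abs)
  have sq: "summable (\<lambda>r. ?w r * (?a r - y)\<^sup>2)" by (rule summable_dunkl_moment[OF assms]) simp
  have one: "summable ?w" by (rule suminf_dunkl_weight[OF assms])
  have "(\<Sum>r. ?w r * (?a r - y) ^ 4) = (\<Sum>r. ?w r * ((?a r - y) * (?a r - y) ^ 3))"
    by (simp add: eval_nat_numeral)
  also have "\<dots> = y * (\<Sum>r. ?w r * ((?a (Suc r) - y) ^ 3 - (?a r - y) ^ 3))"
    by (rule dunkl_stein_identity[OF assms bnd])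
  also have "\<dots> \<le> y * (6 * c\<^sup>2 * (c * y * ?e) + 4 * c ^ 3 * ?e)"
  proof (rule mult_left_mono[OF _ assms(2)])
    have "(\<Sum>r. ?w r * ((?a (Suc r) - y) ^ 3 - (?a r - y) ^ 3))
       \<le> (\<Sum>r. 6 * c\<^sup>2 * (?w r * (?a r - y)\<^sup>2) + 4 * c ^ 3 * ?w r)"
    proof (rule suminf_le)
      show "?w r * ((?a (Suc r) - y) ^ 3 - (?a r - y) ^ 3)
            \<le> 6 * c\<^sup>2 * (?w r * (?a r - y)\<^sup>2) + 4 * c ^ 3 * ?w r" for r
        using mult_left_mono[OF diff[of r] dunkl_weight_nonneg[OF assms, of r]]
        by (simp add: algebra_simps)
      show "summable (\<lambda>r. ?w r * ((?a (Suc r) - y) ^ 3 - (?a r - y) ^ 3))"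
      proof (rule summable_dunkl_weight[OF assms])
        fix r
        let ?C = "(1 + 2 * \<nu> + y) ^ 3"
        have C: "?C \<ge> 0" using assms by simp
        have "\<bar>(?a (Suc r) - y) ^ 3 - (?a r - y) ^ 3\<bar> \<le> ?C * (real (Suc r) + 1) ^ 3 + ?C * (real r + 1) ^ 3"
          using bnd[of r] bnd[of "Suc r"] by linarith
        also have "\<dots> \<le> ?C * (2 * (real r + 1)) ^ 3 + ?C * (real r + 1) ^ 3"
          using C by (intro add_mono mult_left_mono power_mono) auto
        also have "\<dots> = 9 * ?C * (real r + 1) ^ 3"
          by (simp only: power_mult_distrib) simp
        also have "\<dots> \<le> 9 * ?C * (real r + 1) ^ 4"
          using C by (intro mult_left_mono power_increasing) auto
        finally show "\<bar>(?a (Suc r) - y) ^ 3 - (?a r - y) ^ 3\<bar> \<le> 9 * ?C * (real r + 1) ^ 4" .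
      qed
      show "summable (\<lambda>r. 6 * c\<^sup>2 * (?w r * (?a r - y)\<^sup>2) + 4 * c ^ 3 * ?w r)"
        by (intro summable_add summable_mult sq one)
    qed
    also have "\<dots> = 6 * c\<^sup>2 * (\<Sum>r. ?w r * (?a r - y)\<^sup>2) + 4 * c ^ 3 * ?e"
      using sq one suminf_dunkl_weight(1)[OF assms]
      by (simp add: suminf_add[symmetric] summable_mult suminf_mult)
    also have "\<dots> \<le> 6 * c\<^sup>2 * (c * y * ?e) + 4 * c ^ 3 * ?e"
      using dunkl_second_moment[OF assms] assms by (intro add_mono mult_left_mono) (auto simp: c_def)
    finally show "(\<Sum>r. ?w r * ((?a (Suc r) - y) ^ 3 - (?a r - y) ^ 3))
       \<le> 6 * c\<^sup>2 * (c * y * ?e) + 4 * c ^ 3 * ?e" .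
  qed
  also have "\<dots> = 6 * c ^ 3 * y\<^sup>2 * ?e + 4 * c ^ 3 * y * ?e"
    by (simp add: eval_nat_numeral algebra_simps)
  also have "\<dots> \<le> 6 * c ^ 3 * y\<^sup>2 * ?e + 6 * c ^ 3 * y * ?e"
    using c assms suminf_dunkl_weight(3)[OF assms] by (intro add_mono mult_right_mono) auto
  finally show ?thesis by (simp add: c_def algebra_simps)
qed

section \<open>The operator as a mixture\<close>

text \<open>The binomial coefficient times \<open>n - 1\<close> is exactly the normalising constant of the beta prime density.
  Composing \<open>g\<close> with \<open>max 0\<close> makes it continuous, hence measurable, on the whole line.\<close>

lemma T_term_eq_beta_prime:
  assumes g: "continuous_on {0..} g"
  shows "(real (N + 2) - 1) * T_term \<nu> (N + 2) g x (Suc i)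
       = dunkl_weight \<nu> (real (N + 2) * x) (Suc i) * (\<integral>s. g (max 0 s) \<partial>beta_prime N (Suc i))"
proof -
  let ?c = "fact (i + N + 1) / (fact i * fact N) :: real"
  let ?k = "\<lambda>s::real. s ^ i * (1 + s) powi (- int (N + 2) - int (Suc i) + 1) * g s"
  have [measurable]: "(\<lambda>s. g (max 0 s)) \<in> borel_measurable borel"
    by (intro borel_measurable_continuous_onI continuous_on_compose2[OF g] continuous_intros) auto
  have "(\<integral>s. g (max 0 s) \<partial>beta_prime N (Suc i))
      = (\<integral>s. beta_prime_density N i s *\<^sub>R g (max 0 s) \<partial>lborel)"
    unfolding beta_prime_def nat.case
    by (rule integral_density) (auto simp: beta_prime_density_nonneg)
  also have "\<dots> = (\<integral>s. ?c * (indicator {0..} s *\<^sub>R ?k s) \<partial>lborel)"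
  proof (intro Bochner_Integration.integral_cong refl)
    fix s :: real
    have "- int (N + 2) - int (Suc i) + 1 = - int (i + N + 2)" by simp
    then have "(1 + s) powi (- int (N + 2) - int (Suc i) + 1) = inverse ((1 + s) ^ (i + N + 2))"
      by (simp only: power_int_minus power_int_of_nat)
    then show "beta_prime_density N i s *\<^sub>R g (max 0 s) = ?c * (indicator {0..} s *\<^sub>R ?k s)"
      by (auto simp: beta_prime_density_def indicator_def max_def divide_inverse)
  qed
  also have "\<dots> = ?c * (LBINT s:{0..}. ?k s)"
    by (simp only: set_lebesgue_integral_def integral_mult_right_zero)
  also have "?c = (real (N + 2) - 1) * real ((N + 2 + Suc i - 2) choose (Suc i - 1))"
  proof -
    have "real ((i + N + 1) choose i) = fact (i + N + 1) / (fact i * fact (N + 1))"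
      using binomial_fact[of i "i + N + 1", where 'a = real] by simp
    moreover have "fact (N + 1) = (real N + 1) * fact N" by (simp add: algebra_simps)
    ultimately have "(real N + 1) * real ((i + N + 1) choose i) = ?c"
      by (simp only:) (simp add: divide_simps)
    then show ?thesis by (simp add: add_ac)
  qed
  finally show ?thesis by (simp only: T_term_def dunkl_weight_def diff_Suc_1 mult_ac)
qed

lemma T_op_eq_mixture:
  assumes "\<nu> \<ge> 0" and g: "continuous_on {0..} g"
    and sm: "summable (\<lambda>r. dunkl_weight \<nu> (real (N + 2) * x) r * (\<integral>s. g (max 0 s) \<partial>beta_prime N r))"
  shows "T_op \<nu> (N + 2) g x
       = (\<Sum>r. dunkl_weight \<nu> (real (N + 2) * x) r * (\<integral>s. g (max 0 s) \<partial>beta_prime N r))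
         / dunkl_exp \<nu> (real (N + 2) * x)"
proof -
  let ?n = "real (N + 2)"
  let ?h = "\<lambda>r. dunkl_weight \<nu> (?n * x) r * (\<integral>s. g (max 0 s) \<partial>beta_prime N r)"
  have T: "T_term \<nu> (N + 2) g x (Suc i) = ?h (Suc i) / (?n - 1)" for i
    using T_term_eq_beta_prime[OF g, of N \<nu> x i] by (simp add: field_simps)
  have "(\<lambda>s. g (max 0 s)) \<in> borel_measurable borel"
    by (intro borel_measurable_continuous_onI continuous_on_compose2[OF g] continuous_intros) auto
  from has_bochner_integral_beta_prime_0[OF this, of N]
  have "(\<integral>s. g (max 0 s) \<partial>beta_prime N 0) = g 0"
    by (simp add: has_bochner_integral_integral_eq)
  then have h0: "?h 0 = g 0"
    using assms(1) by (simp add: dunkl_weight_def)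
  have "(\<Sum>i. T_term \<nu> (N + 2) g x (Suc i)) = (\<Sum>i. ?h (Suc i)) / (?n - 1)"
    unfolding T using sm by (intro suminf_divide) (subst summable_Suc_iff)
  also have "(\<Sum>i. ?h (Suc i)) = suminf ?h - g 0"
    using suminf_split_head[OF sm] h0 by simp
  finally have S: "(\<Sum>i. T_term \<nu> (N + 2) g x (Suc i)) = (suminf ?h - g 0) / (?n - 1)" .
  have eq: "k / e * ((H - b) / k) + b / e = H / e" if "k \<noteq> 0" for k e H b :: real
    using that by (simp flip: add_divide_distrib)
  show ?thesis unfolding T_op_def S by (rule eq) simp
qed

section \<open>Weighted increments\<close>

text \<open>The way from \<open>x\<close> to \<open>t\<close> is cut into at most \<open>1 + \<bar>t - x\<bar> / \<delta>\<close> equal steps of length at most \<open>\<delta>\<close>.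
  All intermediate points are nonnegative because they lie between \<open>x\<close> and \<open>t\<close>; the weight at each of
  them is at most \<open>2 (1 + x\<^sup>2) (1 + (t - x)\<^sup>2)\<close>.\<close>

lemma weighted_increment_le:
  fixes g :: "real \<Rightarrow> real"
  assumes W: "\<And>x h. x \<ge> 0 \<Longrightarrow> \<bar>h\<bar> \<le> \<delta> \<Longrightarrow> x + h \<ge> 0 \<Longrightarrow>
                 \<bar>g (x + h) - g x\<bar> \<le> W * ((1 + h\<^sup>2) * (1 + x\<^sup>2))"
    and "\<delta> > 0" "W \<ge> 0" "x \<ge> 0" "t \<ge> 0"
  shows "\<bar>g t - g x\<bar> \<le> 2 * W * (1 + \<delta>\<^sup>2) * (1 + x\<^sup>2) * ((1 + \<bar>t - x\<bar> / \<delta>) * (1 + (t - x)\<^sup>2))"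
proof -
  define m where "m = Suc (nat \<lfloor>\<bar>t - x\<bar> / \<delta>\<rfloor>)"
  define h where "h = (t - x) / real m"
  have m: "\<bar>t - x\<bar> / \<delta> \<le> real m" "real m \<le> 1 + \<bar>t - x\<bar> / \<delta>" "m > 0"
    using assms(2) by (auto simp: m_def) (linarith | simp add: le_floor_iff)+
  have h: "\<bar>h\<bar> \<le> \<delta>" using m(1,3) assms(2) by (simp add: h_def field_simps)
  have step: "\<bar>g (x + real (Suc k) * h) - g (x + real k * h)\<bar> \<le> W * ((1 + \<delta>\<^sup>2) * (2 * (1 + x\<^sup>2) * (1 + (t - x)\<^sup>2)))"
    if "k < m" for k
  proof -
    have pos: "x + real j * h \<ge> 0" if "j \<le> m" for j
    proof -
      have "x + real j * h = (1 - real j / real m) * x + (real j / real m) * t"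
        using m(3) by (simp add: h_def field_simps)
      also have "\<dots> \<ge> 0" using that m(3) assms(4,5) by (intro add_nonneg_nonneg mult_nonneg_nonneg) auto
      finally show ?thesis .
    qed
    have kh: "(real k * h)\<^sup>2 \<le> (t - x)\<^sup>2"
    proof (rule power2_le_iff_abs_le[THEN iffD2, OF abs_ge_zero, of "real k * h" "t - x", simplified])
      have "\<bar>real k * h\<bar> \<le> real m * \<bar>h\<bar>" using that by (simp add: abs_mult mult_right_mono)
      also have "\<dots> = \<bar>t - x\<bar>" using m(3) by (simp add: h_def)
      finally show "\<bar>real k * h\<bar> \<le> \<bar>t - x\<bar>" .
    qed
    have "1 + (x + real k * h)\<^sup>2 \<le> 2 * (1 + x\<^sup>2) * (1 + (real k * h)\<^sup>2)"
    proof -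
      have "2 * (1 + x\<^sup>2) * (1 + (real k * h)\<^sup>2) - (1 + (x + real k * h)\<^sup>2)
            = 1 + (x - real k * h)\<^sup>2 + 2 * (x * (real k * h))\<^sup>2"
        by (simp add: power2_eq_square algebra_simps)
      also have "\<dots> \<ge> 0" by simp
      finally show ?thesis by linarith
    qed
    also have "\<dots> \<le> 2 * (1 + x\<^sup>2) * (1 + (t - x)\<^sup>2)" using kh by (intro mult_left_mono) auto
    finally have 1: "1 + (x + real k * h)\<^sup>2 \<le> 2 * (1 + x\<^sup>2) * (1 + (t - x)\<^sup>2)" .
    have 2: "1 + h\<^sup>2 \<le> 1 + \<delta>\<^sup>2" using h assms(2) by (simp add: abs_le_square_iff[symmetric])
    have "\<bar>g ((x + real k * h) + h) - g (x + real k * h)\<bar> \<le> W * ((1 + h\<^sup>2) * (1 + (x + real k * h)\<^sup>2))"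
      using pos[of k] pos[of "Suc k"] that h by (intro W) (auto simp: algebra_simps)
    also have "\<dots> \<le> W * ((1 + \<delta>\<^sup>2) * (2 * (1 + x\<^sup>2) * (1 + (t - x)\<^sup>2)))"
      using 1 2 assms(3) by (intro mult_left_mono mult_mono) auto
    finally have "\<bar>g ((x + real k * h) + h) - g (x + real k * h)\<bar> \<le> \<dots>" .
    moreover have "x + real (Suc k) * h = (x + real k * h) + h" by (simp add: distrib_right)
    ultimately show ?thesis by (simp only:)
  qed
  define B where "B = W * ((1 + \<delta>\<^sup>2) * (2 * (1 + x\<^sup>2) * (1 + (t - x)\<^sup>2)))"
  have B: "B \<ge> 0" using assms(3) by (simp add: B_def)
  have "(\<Sum>k<m. \<bar>g (x + real (Suc k) * h) - g (x + real k * h)\<bar>) \<le> (\<Sum>k<m. B)"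
    unfolding B_def by (intro sum_mono step) simp
  also have "\<dots> = real m * B" by simp
  also have "\<dots> \<le> (1 + \<bar>t - x\<bar> / \<delta>) * B" using m(2) B by (rule mult_right_mono)
  finally have *: "(\<Sum>k<m. \<bar>g (x + real (Suc k) * h) - g (x + real k * h)\<bar>) \<le> \<dots>" .
  have "g t - g x = (\<Sum>k<m. g (x + real (Suc k) * h) - g (x + real k * h))"
    using m(3) by (subst sum_lessThan_telescope) (simp add: h_def)
  then have "\<bar>g t - g x\<bar> \<le> (\<Sum>k<m. \<bar>g (x + real (Suc k) * h) - g (x + real k * h)\<bar>)"
    by simp
  also note *
  finally show ?thesis by (simp only: B_def mult_ac)
qed

text \<open>Reduces the weighted increment at scaled distance \<open>p = \<bar>t - x\<bar> / \<delta>\<close> to a single fourth power.\<close>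

lemma cubic_le_quartic:
  fixes p :: real
  assumes "p \<ge> 0"
  shows "(1 + p) * (1 + p\<^sup>2) \<le> 4 * (1 + p ^ 4)"
proof -
  show ?thesis
  proof (cases "p \<le> 1")
    case True
    have "(1 + p) * (1 + p\<^sup>2) \<le> 2 * 2"
      using True assms by (intro mult_mono) (auto simp: power_le_one)
    also have "\<dots> \<le> 4 * (1 + p ^ 4)" using zero_le_power[OF assms, of 4] by simp
    finally show ?thesis .
  next
    case False
    have "(1 + p) * (1 + p\<^sup>2) \<le> (2 * p) * (2 * p\<^sup>2)"
      using False one_le_power[of p 2] by (intro mult_mono) auto
    also have "\<dots> = 4 * p ^ 3" by (simp add: power2_eq_square power3_eq_cube)
    also have "\<dots> \<le> 4 * p ^ 4" using False by (intro mult_left_mono power_increasing) auto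
    finally show ?thesis by simp
  qed
qed

section \<open>Deviation of the mixture from a point\<close>

lemma power4_sum_le:
  fixes a b c :: real
  shows "(a + b + c) ^ 4 \<le> 27 * (a ^ 4 + b ^ 4 + c ^ 4)"
proof -
  have sq: "(u + v + w)\<^sup>2 \<le> 3 * (u\<^sup>2 + v\<^sup>2 + w\<^sup>2)" for u v w :: real
  proof -
    have "3 * (u\<^sup>2 + v\<^sup>2 + w\<^sup>2) - (u + v + w)\<^sup>2 = (u - v)\<^sup>2 + (v - w)\<^sup>2 + (u - w)\<^sup>2"
      by (simp add: power2_eq_square algebra_simps)
    also have "\<dots> \<ge> 0" by simp
    finally show ?thesis by linarith
  qed
  have p4: "u ^ 4 = (u\<^sup>2)\<^sup>2" for u :: real by simp
  have "(a + b + c) ^ 4 \<le> (3 * (a\<^sup>2 + b\<^sup>2 + c\<^sup>2))\<^sup>2"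
    unfolding p4 by (intro power_mono sq) auto
  also have "\<dots> = 9 * (a\<^sup>2 + b\<^sup>2 + c\<^sup>2)\<^sup>2" by (simp only: power_mult_distrib) simp
  also have "\<dots> \<le> 9 * (3 * (a ^ 4 + b ^ 4 + c ^ 4))"
    unfolding p4 by (intro mult_left_mono sq) auto
  finally show ?thesis by simp
qed

text \<open>Everything that depends on the index \<open>r\<close> is expressed by the deviation \<open>d\<close> of \<open>a = dunkl_step \<nu> r\<close> from
  \<open>y = n x\<close>. Replacing \<open>r\<close> by \<open>a\<close> costs \<open>2 \<nu>\<close>, and replacing the denominator \<open>n\<close> by \<open>n - 2\<close> costs
  \<open>2 x\<close>; after scaling, both errors are of order \<open>1 / n\<close>.\<close>

lemma mixing_deviation_le:
  fixes n r a x \<nu> :: real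
  assumes "n \<ge> 7" "x \<ge> 0" "\<nu> \<ge> 0" "r \<ge> 0" "r \<le> a" "a \<le> r + 2 * \<nu>"
  defines "m \<equiv> r / (n - 2)" and "d \<equiv> a - n * x"
  shows "27 * (69 * (1 + m) ^ 4 + n\<^sup>2 * (m - x) ^ 4) \<le> 10 ^ 6 * (1 + \<nu> ^ 4) * (1 + x ^ 4 + d ^ 4 / n\<^sup>2)"
proof -
  define D where "D = d ^ 4 / n\<^sup>2"
  have n2: "n\<^sup>2 \<ge> 1" using assms(1) by (simp add: one_le_power)
  have D0: "D \<ge> 0" by (simp add: D_def)
  have D4: "d ^ 4 / n ^ 4 \<le> D"
  proof -
    have "n\<^sup>2 \<le> n ^ 4" using assms(1) by (intro power_increasing) auto
    then show ?thesis unfolding D_def using assms(1) by (intro divide_left_mono) auto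
  qed
  have div: "t / (n - 2) \<le> t * (2 / n)" if "t \<ge> 0" for t
  proof -
    have "1 / (n - 2) \<le> 2 / n" using assms(1) by (simp add: field_simps)
    from mult_left_mono[OF this that] show ?thesis by simp
  qed
  have m0: "m \<ge> 0" using assms(1,4) by (simp add: m_def)
  have "m \<le> (\<bar>d\<bar> + n * x) / (n - 2)"
    unfolding m_def d_def using assms by (intro divide_right_mono) auto
  also have "\<dots> \<le> (\<bar>d\<bar> + n * x) * (2 / n)" using assms by (intro div) auto
  also have "\<dots> = 2 * x + 2 * \<bar>d\<bar> / n" using assms(1) by (simp add: field_simps)
  finally have "(1 + m) ^ 4 \<le> (1 + 2 * x + 2 * \<bar>d\<bar> / n) ^ 4"
    using m0 by (intro power_mono) auto
  also have "\<dots> \<le> 27 * (1 ^ 4 + (2 * x) ^ 4 + (2 * \<bar>d\<bar> / n) ^ 4)" by (rule power4_sum_le)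
  also have "\<dots> = 27 * (1 + 16 * x ^ 4 + 16 * (d ^ 4 / n ^ 4))"
    by (simp add: power_mult_distrib power_divide)
  also have "\<dots> \<le> 27 * (1 + 16 * x ^ 4 + 16 * D)" using D4 by simp
  finally have 1: "(1 + m) ^ 4 \<le> 27 * (1 + 16 * x ^ 4 + 16 * D)" .
  have "m - x = (d - (a - r) + 2 * x) / (n - 2)"
    using assms(1) by (simp add: m_def d_def field_simps)
  then have "\<bar>m - x\<bar> = \<bar>d - (a - r) + 2 * x\<bar> / (n - 2)" using assms(1) by simp
  also have "\<dots> \<le> (\<bar>d\<bar> + 2 * \<nu> + 2 * x) / (n - 2)"
    using assms by (intro divide_right_mono) auto
  also have "\<dots> \<le> (\<bar>d\<bar> + 2 * \<nu> + 2 * x) * (2 / n)" using assms by (intro div) auto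
  finally have "\<bar>m - x\<bar> ^ 4 \<le> ((\<bar>d\<bar> + 2 * \<nu> + 2 * x) * (2 / n)) ^ 4" by (intro power_mono) auto
  then have "n\<^sup>2 * (m - x) ^ 4 \<le> n\<^sup>2 * ((\<bar>d\<bar> + 2 * \<nu> + 2 * x) * (2 / n)) ^ 4"
    by (intro mult_left_mono) auto
  also have "\<dots> = 16 / n\<^sup>2 * (\<bar>d\<bar> + 2 * \<nu> + 2 * x) ^ 4"
  proof -
    have "n\<^sup>2 * (z * (2 / n)) ^ 4 = 16 / n\<^sup>2 * z ^ 4" for z
      using assms(1) by (simp add: power_mult_distrib power_divide eval_nat_numeral)
    then show ?thesis .
  qed
  also have "\<dots> \<le> 16 / n\<^sup>2 * (27 * (\<bar>d\<bar> ^ 4 + (2 * \<nu>) ^ 4 + (2 * x) ^ 4))"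
    by (intro mult_left_mono power4_sum_le) auto
  also have "\<dots> = 432 * D + 6912 * (\<nu> ^ 4 / n\<^sup>2) + 6912 * (x ^ 4 / n\<^sup>2)"
    by (simp add: D_def power_mult_distrib add_divide_distrib distrib_left)
  also have "\<dots> \<le> 432 * D + 6912 * \<nu> ^ 4 + 6912 * x ^ 4"
  proof -
    have "t / n\<^sup>2 \<le> t" if "t \<ge> 0" for t
      using n2 that mult_left_mono[of 1 "n\<^sup>2" t] by (subst pos_divide_le_eq) auto
    then show ?thesis by (intro add_mono mult_left_mono) auto
  qed
  finally have 2: "n\<^sup>2 * (m - x) ^ 4 \<le> 432 * D + 6912 * \<nu> ^ 4 + 6912 * x ^ 4" .
  have nn: "\<nu> ^ 4 \<ge> 0" "x ^ 4 \<ge> 0" "\<nu> ^ 4 * x ^ 4 \<ge> 0" "\<nu> ^ 4 * D \<ge> 0" using D0 by auto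
  have "27 * (69 * (1 + m) ^ 4 + n\<^sup>2 * (m - x) ^ 4)
      \<le> 27 * (69 * (27 * (1 + 16 * x ^ 4 + 16 * D)) + (432 * D + 6912 * \<nu> ^ 4 + 6912 * x ^ 4))"
    using 1 2 by (intro mult_left_mono add_mono) auto
  also have "\<dots> \<le> 10 ^ 6 * (1 + x ^ 4 + D + \<nu> ^ 4 + \<nu> ^ 4 * x ^ 4 + \<nu> ^ 4 * D)"
    using nn D0 by simp
  also have "\<dots> = 10 ^ 6 * (1 + \<nu> ^ 4) * (1 + x ^ 4 + D)" by (simp add: algebra_simps)
  finally show ?thesis by (simp only: D_def)
qed

text \<open>The distance from \<open>s\<close> to \<open>x\<close> is split at the mean \<open>m\<close> of the beta prime law: the part from \<open>s\<close> to \<open>m\<close> is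
  the fourth central moment, and the part from \<open>m\<close> to \<open>x\<close> depends on \<open>r\<close> only.\<close>

lemma beta_prime_mean_deviation:
  fixes f :: "real \<Rightarrow> real"
  assumes "\<nu> \<ge> 0" "x \<ge> 0" "N \<ge> 5" "A \<ge> 0" "f \<in> borel_measurable borel"
  defines "n \<equiv> real (N + 2)"
  assumes f: "\<And>s. s \<ge> 0 \<Longrightarrow> \<bar>f s - c\<bar> \<le> A * (1 + n\<^sup>2 * (s - x) ^ 4)"
  shows "\<bar>(\<integral>s. f s \<partial>beta_prime N r) - c\<bar>
     \<le> A * (1 + 10 ^ 6 * (1 + \<nu> ^ 4) * (1 + x ^ 4 + (dunkl_step \<nu> r - n * x) ^ 4 / n\<^sup>2))"
proof -
  interpret prob_space "beta_prime N r" by (rule prob_space_beta_prime)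
  define m where "m = real r / real N"
  have N: "real N = n - 2" by (simp add: n_def)
  have [measurable]: "f \<in> borel_measurable (beta_prime N r)"
    using assms(5) by simp
  note M = beta_prime_central_moment4_le[OF assms(3), of r, folded m_def]
  let ?B = "\<lambda>s. A * (1 + 27 * n\<^sup>2 * (m - x) ^ 4) + (27 * A * n\<^sup>2) * (s - m) ^ 4"
  have iB: "integrable (beta_prime N r) ?B" using M(1) by simp
  have le: "AE s in beta_prime N r. \<bar>f s - c\<bar> \<le> ?B s"
    using AE_beta_prime_nonneg
  proof eventually_elim
    case (elim s)
    have "(s - x) ^ 4 \<le> 27 * ((s - m) ^ 4 + (m - x) ^ 4)"
      using power4_sum_le[of "s - m" "m - x" 0] by simp
    then have "A * (1 + n\<^sup>2 * (s - x) ^ 4) \<le> A * (1 + n\<^sup>2 * (27 * ((s - m) ^ 4 + (m - x) ^ 4)))"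
      using assms(4) by (intro mult_left_mono add_left_mono) auto
    with f[OF elim] show ?case by (simp add: algebra_simps)
  qed
  have id: "integrable (beta_prime N r) (\<lambda>s. f s - c)"
    by (rule Bochner_Integration.integrable_bound[OF iB]) (use le in auto)
  have "integrable (beta_prime N r) f"
    using Bochner_Integration.integrable_add[OF id, of "\<lambda>_. c"] by simp
  then have "(\<integral>s. f s \<partial>beta_prime N r) - c = (\<integral>s. f s - c \<partial>beta_prime N r)"
    using prob_space by (simp add: Bochner_Integration.integral_diff)
  also have "\<bar>\<dots>\<bar> \<le> (\<integral>s. \<bar>f s - c\<bar> \<partial>beta_prime N r)" by (rule integral_abs_bound)
  also have "\<dots> \<le> (\<integral>s. ?B s \<partial>beta_prime N r)"
    using id iB le by (intro integral_mono_AE) auto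
  also have "\<dots> = A * (1 + 27 * n\<^sup>2 * (m - x) ^ 4) + (27 * A * n\<^sup>2) * (\<integral>s. (s - m) ^ 4 \<partial>beta_prime N r)"
    using M(1) prob_space by simp
  also have "\<dots> \<le> A * (1 + 27 * n\<^sup>2 * (m - x) ^ 4) + (27 * A * n\<^sup>2) * (69 * (1 + m) ^ 4 / n\<^sup>2)"
    using M(2) assms(4) by (intro add_left_mono mult_left_mono) (auto simp: N)
  also have "\<dots> = A * (1 + 27 * (69 * (1 + m) ^ 4 + n\<^sup>2 * (m - x) ^ 4))"
    using N assms(3) by (simp add: algebra_simps) 
  also have "\<dots> \<le> A * (1 + 10 ^ 6 * (1 + \<nu> ^ 4) * (1 + x ^ 4 + (dunkl_step \<nu> r - n * x) ^ 4 / n\<^sup>2))"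
    unfolding m_def N using assms dunkl_step_bounds[OF assms(1), of r]
    by (intro mult_left_mono add_left_mono mixing_deviation_le) auto
  finally show ?thesis .
qed

text \<open>The bounds for the single laws are averaged with the mixing weights. With \<open>y = n x\<close> the fourth moment
  of the weights is \<open>O(n\<^sup>2 x\<^sup>2 + n x)\<close>, and the division by \<open>n\<^sup>2\<close> leaves a bound free of \<open>n\<close>.\<close>

lemma T_op_deviation:
  fixes g :: "real \<Rightarrow> real"
  assumes "\<nu> \<ge> 0" "x \<ge> 0" "N \<ge> 5" "A \<ge> 0" and g: "continuous_on {0..} g"
  defines "n \<equiv> real (N + 2)"
  assumes le: "\<And>s. s \<ge> 0 \<Longrightarrow> \<bar>g s - g x\<bar> \<le> A * (1 + n\<^sup>2 * (s - x) ^ 4)"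
  shows "\<bar>T_op \<nu> (N + 2) g x - g x\<bar>
     \<le> A * (1 + 10 ^ 6 * (1 + \<nu> ^ 4) * (1 + 12 * (1 + 2 * \<nu>) ^ 3)) * (1 + x\<^sup>2)\<^sup>2"
proof -
  define y where "y = n * x"
  have n: "n \<ge> 7" using assms(3) by (simp add: n_def)
  have y: "y \<ge> 0" using n assms(2) by (simp add: y_def)
  let ?w = "dunkl_weight \<nu> y" and ?e = "dunkl_exp \<nu> y"
  let ?d = "\<lambda>r. dunkl_step \<nu> r - y"
  let ?L = "\<lambda>r. \<integral>s. g (max 0 s) \<partial>beta_prime N r"
  define C where "C = 10 ^ 6 * (1 + \<nu> ^ 4)"
  have C: "C \<ge> 0" by (simp add: C_def)
  let ?U = "\<lambda>r. A * (1 + C * (1 + x ^ 4)) * ?w r + A * C / n\<^sup>2 * (?w r * ?d r ^ 4)"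
  have e: "?e \<ge> 1" and w: "summable ?w" "suminf ?w = ?e"
    using suminf_dunkl_weight[OF assms(1) y] by auto
  have s4: "summable (\<lambda>r. ?w r * ?d r ^ 4)" by (rule summable_dunkl_moment[OF assms(1) y]) simp
  have "(\<lambda>s. g (max 0 s)) \<in> borel_measurable borel"
    by (intro borel_measurable_continuous_onI continuous_on_compose2[OF g] continuous_intros) auto
  then have L: "\<bar>?L r - g x\<bar> \<le> A * (1 + C * (1 + x ^ 4 + ?d r ^ 4 / n\<^sup>2))" for r
    unfolding C_def y_def n_def using assms(1-4) le
    by (intro beta_prime_mean_deviation) (auto simp: n_def)
  have U: "\<bar>?w r * (?L r - g x)\<bar> \<le> ?U r" for r
  proof -
    have wr: "?w r \<ge> 0" by (rule dunkl_weight_nonneg[OF assms(1) y])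
    then have "\<bar>?w r * (?L r - g x)\<bar> = ?w r * \<bar>?L r - g x\<bar>" by (simp only: abs_mult abs_of_nonneg)
    also have "\<dots> \<le> ?w r * (A * (1 + C * (1 + x ^ 4 + ?d r ^ 4 / n\<^sup>2)))"
      using L wr by (rule mult_left_mono)
    also have "\<dots> = ?U r" by (simp add: algebra_simps)
    finally show ?thesis .
  qed
  have sU: "summable ?U" by (intro summable_add summable_mult w s4)
  have sa: "summable (\<lambda>r. \<bar>?w r * (?L r - g x)\<bar>)"
    by (rule summable_comparison_test'[OF sU]) (use U in simp)
  then have sd: "summable (\<lambda>r. ?w r * (?L r - g x))" by (rule summable_rabs_cancel)
  have "(\<lambda>r. ?w r * ?L r) = (\<lambda>r. ?w r * (?L r - g x) + g x * ?w r)" by (auto simp: algebra_simps)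
  then have sL: "summable (\<lambda>r. ?w r * ?L r)" using sd w(1) by (simp add: summable_add summable_mult)
  have "T_op \<nu> (N + 2) g x - g x = ((\<Sum>r. ?w r * ?L r) - g x * ?e) / ?e"
    using T_op_eq_mixture[OF assms(1) g, of N x] sL e
    by (simp add: y_def n_def diff_divide_distrib)
  also have "(\<Sum>r. ?w r * ?L r) - g x * ?e = (\<Sum>r. ?w r * (?L r - g x))"
    using sums_diff[OF summable_sums[OF sL] sums_mult[OF summable_sums[OF w(1)], of "g x"]] w(2)
    by (intro sums_unique) (simp add: right_diff_distrib mult.commute)
  finally have "\<bar>T_op \<nu> (N + 2) g x - g x\<bar> = \<bar>\<Sum>r. ?w r * (?L r - g x)\<bar> / ?e"
    using e by simp
  also have "\<dots> \<le> suminf ?U / ?e"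
  proof (rule divide_right_mono)
    show "\<bar>\<Sum>r. ?w r * (?L r - g x)\<bar> \<le> suminf ?U"
      using summable_rabs[OF sa] suminf_le[OF U sa sU] by linarith
  qed (use e in simp)
  also have "suminf ?U = A * (1 + C * (1 + x ^ 4)) * ?e + A * C / n\<^sup>2 * (\<Sum>r. ?w r * ?d r ^ 4)"
    unfolding w(2)[symmetric]
    by (intro sums_unique[symmetric] sums_add sums_mult summable_sums w(1) s4)
  also have "\<dots> / ?e \<le> (A * (1 + C * (1 + x ^ 4)) * ?e
       + A * C / n\<^sup>2 * (6 * (1 + 2 * \<nu>) ^ 3 * (y\<^sup>2 + y) * ?e)) / ?e"
    using dunkl_fourth_moment[OF assms(1) y] assms(4) C e
    by (intro divide_right_mono add_left_mono mult_left_mono) auto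
  also have "\<dots> = A * (1 + C * (1 + x ^ 4)) + A * C * (6 * (1 + 2 * \<nu>) ^ 3 * ((y\<^sup>2 + y) / n\<^sup>2))"
  proof -
    have "(a * t + b / k * (c * z * t)) / t = a + b * (c * (z / k))" if "t \<noteq> 0" for a b c k t z :: real
      using that by (simp add: add_divide_distrib)
    then show ?thesis using e by simp
  qed
  also have "\<dots> = A * (1 + C * (1 + x ^ 4 + 6 * (1 + 2 * \<nu>) ^ 3 * ((y\<^sup>2 + y) / n\<^sup>2)))"
    by (simp add: algebra_simps)
  also have "\<dots> \<le> A * ((1 + x\<^sup>2)\<^sup>2 + C * ((1 + x\<^sup>2)\<^sup>2 + 6 * (1 + 2 * \<nu>) ^ 3 * (2 * (1 + x\<^sup>2)\<^sup>2)))"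
  proof -
    have ex: "(1 + x\<^sup>2)\<^sup>2 = 1 + 2 * x\<^sup>2 + x ^ 4"
      by (simp add: eval_nat_numeral algebra_simps)
    have yn: "(y\<^sup>2 + y) / n\<^sup>2 = x\<^sup>2 + x / n"
      using n by (simp add: y_def power2_eq_square field_simps)
    have "x / n \<le> x" using divide_left_mono[of 1 n x] n assms(2) by simp
    also have "x \<le> 1 + x\<^sup>2"
      using zero_le_power2[of "x - 1/2"] by (simp add: power2_eq_square algebra_simps)
    finally have "(y\<^sup>2 + y) / n\<^sup>2 \<le> 1 + 2 * x\<^sup>2" unfolding yn by simp
    also have "\<dots> \<le> 2 * (1 + x\<^sup>2)\<^sup>2" unfolding ex using zero_le_power2[of x] by simp
    finally have "(y\<^sup>2 + y) / n\<^sup>2 \<le> 2 * (1 + x\<^sup>2)\<^sup>2" .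
    moreover have "1 \<le> (1 + x\<^sup>2)\<^sup>2" "1 + x ^ 4 \<le> (1 + x\<^sup>2)\<^sup>2" unfolding ex by simp_all
    ultimately show ?thesis using assms(1,4) C by (intro mult_left_mono add_mono) auto
  qed
  also have "\<dots> = A * (1 + C * (1 + 12 * (1 + 2 * \<nu>) ^ 3)) * (1 + x\<^sup>2)\<^sup>2"
    by (simp add: algebra_simps)
  finally show ?thesis by (simp only: C_def)
qed

text \<open>The increment bound at \<open>\<delta> = 1 / sqrt n\<close> supplies the constant \<open>A\<close> of the deviation estimate, with
  \<open>1 + \<delta>\<^sup>2 = 1 + 1 / n\<close>.\<close>

theorem theorem10:
  fixes \<nu> :: real
  assumes "\<nu> \<ge> 0"
  shows "\<exists>M::real. \<forall>g \<in> C_rho_star. \<forall>n::nat. n > 6 \<longrightarrow>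
           (SUP x\<in>{0..}. ereal (\<bar>T_op \<nu> n g x - g x\<bar> / (1 + x\<^sup>2) ^ 3))
             \<le> ereal (M * (1 + 1 / real n)) * wmod g (1 / sqrt (real n))"
proof -
  define K where "K = 1 + 10 ^ 6 * (1 + \<nu> ^ 4) * (1 + 12 * (1 + 2 * \<nu>) ^ 3)"
  have K: "K > 0" using assms unfolding K_def by (intro add_pos_nonneg) auto
  have "(SUP x\<in>{0..}. ereal (\<bar>T_op \<nu> n g x - g x\<bar> / (1 + x\<^sup>2) ^ 3))
          \<le> ereal (8 * K * (1 + 1 / real n)) * wmod g (1 / sqrt (real n))"
    if g: "g \<in> C_rho_star" and n: "n > 6" for g and n :: nat
  proof -
    define \<delta> where "\<delta> = 1 / sqrt (real n)"
    have \<delta>: "\<delta> > 0" "\<delta>\<^sup>2 = 1 / real n" using n by (simp_all add: \<delta>_def power_divide)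
    have cont: "continuous_on {0..} g" using g by (simp add: C_rho_star_def C_rho_def)
    have mod_le: "ereal (\<bar>g (x + h) - g x\<bar> / ((1 + h\<^sup>2) * (1 + x\<^sup>2))) \<le> wmod g \<delta>"
      if "x \<ge> 0" "\<bar>h\<bar> \<le> \<delta>" "x + h \<ge> 0" for x h
      unfolding wmod_def by (rule SUP_upper2[of "(x, h)"]) (use that in auto)
    have nonneg: "wmod g \<delta> \<ge> 0" using mod_le[of 0 0] \<delta>(1) by (simp add: zero_ereal_def)
    \<comment> \<open>The infinite case is trivial once the constant in front is positive; otherwise the modulus is a real number \<open>W\<close>.\<close>
    show ?thesis
    proof (cases "wmod g \<delta>")
      case PInf
      have "8 * K * (1 + 1 / real n) > 0" using K by (intro mult_pos_pos add_pos_nonneg) auto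
      moreover have "ereal c * \<infinity> = \<infinity>" if "c > 0" for c :: real using that by simp
      ultimately have *: "ereal (8 * K * (1 + 1 / real n)) * wmod g (1 / sqrt (real n)) = \<infinity>"
        using PInf unfolding \<delta>_def by (simp only:)
      show ?thesis unfolding * by simp
    next
      case MInf
      then show ?thesis using nonneg by simp
    next
      case (real W)
      have W: "W \<ge> 0" using nonneg real by simp
      have incr: "\<bar>g (x + h) - g x\<bar> \<le> W * ((1 + h\<^sup>2) * (1 + x\<^sup>2))"
        if "x \<ge> 0" "\<bar>h\<bar> \<le> \<delta>" "x + h \<ge> 0" for x h
      proof -
        have "(1 + h\<^sup>2) * (1 + x\<^sup>2) > 0" by (intro mult_pos_pos add_pos_nonneg) auto
        then show ?thesis using mod_le[OF that] real by (simp add: pos_divide_le_eq)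
      qed
      obtain N where N: "n = N + 2" "N \<ge> 5"
        using n by (intro that[of "n - 2"]) auto
      have "\<bar>T_op \<nu> n g x - g x\<bar> / (1 + x\<^sup>2) ^ 3 \<le> 8 * K * (1 + 1 / real n) * W"
        if x: "x \<ge> 0" for x
      proof -
        define A where "A = 8 * (1 + 1 / real n) * (1 + x\<^sup>2) * W"
        have A: "A \<ge> 0" using W by (simp add: A_def)
        have "\<bar>g s - g x\<bar> \<le> A * (1 + (real n)\<^sup>2 * (s - x) ^ 4)" if s: "s \<ge> 0" for s
        proof -
          define p where "p = \<bar>s - x\<bar> / \<delta>"
          have p: "p \<ge> 0" using \<delta>(1) by (simp add: p_def)
          have p2: "p\<^sup>2 = real n * (s - x)\<^sup>2" by (simp add: p_def power_divide \<delta>(2))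
          have p4: "p ^ 4 = (real n)\<^sup>2 * (s - x) ^ 4"
          proof -
            have "p ^ 4 = (p\<^sup>2)\<^sup>2" by simp
            also have "\<dots> = (real n)\<^sup>2 * (s - x) ^ 4" unfolding p2 by (simp add: power_mult_distrib)
            finally show ?thesis .
          qed
          have "(s - x)\<^sup>2 \<le> p\<^sup>2" unfolding p2 using n by (simp add: mult_le_cancel_right1)
          have "\<bar>g s - g x\<bar> \<le> 2 * W * (1 + \<delta>\<^sup>2) * (1 + x\<^sup>2) * ((1 + p) * (1 + (s - x)\<^sup>2))"
            unfolding p_def using weighted_increment_le[of \<delta> g W, OF incr \<delta>(1) W x s] by blast
          also have "\<dots> \<le> 2 * W * (1 + \<delta>\<^sup>2) * (1 + x\<^sup>2) * ((1 + p) * (1 + p\<^sup>2))"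
            using W p \<open>(s - x)\<^sup>2 \<le> p\<^sup>2\<close> by (intro mult_left_mono add_left_mono) auto
          also have "\<dots> \<le> 2 * W * (1 + \<delta>\<^sup>2) * (1 + x\<^sup>2) * (4 * (1 + p ^ 4))"
            using W by (intro mult_left_mono cubic_le_quartic p) auto
          also have "\<dots> = A * (1 + p ^ 4)" unfolding A_def \<delta>(2) by (simp add: algebra_simps)
          finally show ?thesis by (simp add: p4)
        qed
        then have "\<bar>T_op \<nu> n g x - g x\<bar> \<le> A * K * (1 + x\<^sup>2)\<^sup>2"
          unfolding K_def N(1) by (intro T_op_deviation assms x N A cont)
        also have "\<dots> = 8 * K * (1 + 1 / real n) * W * (1 + x\<^sup>2) ^ 3"
          by (simp add: A_def power2_eq_square power3_eq_cube mult_ac)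
        finally show ?thesis by (subst pos_divide_le_eq) (auto intro!: zero_less_power add_pos_nonneg)
      qed
      then show ?thesis using real by (intro SUP_least) (simp add: \<delta>_def)
    qed
  qed
  then show ?thesis by blast
qed

end
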